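(* Let $(k(n))_{n\ge 1}$ be a sequence of positive integers with $k(n)\to+\infty$, and let $X=\{\{X_{k,n},\ 1\le k\le k(n)\},\ n\ge 1\}$ be an array of random variables defined on the same probability space $(\Omega,\mathcal{A},\mathbb{P})$ such that, for each $n\ge 1$, the variables $X_{1,n},\dots,X_{k(n),n}$ are independent. Suppose that: (GN1) for all $n\ge 1$ and all $1\le k\le k(n)$, $X_{k,n}\sim\mathcal{G}^{\ast}(p_{k,n})$ (corrected geometric law) with $0<p_{k,n}=1-q_{k,n}<1$; (GN2) $\sup_{1\le k\le k(n)} q_{k,n}/p_{k,n}^2\to 0$ as $n\to+\infty$; (GN3) for some $\lambda\in\,]0,+\infty[$ and for each $h\in\{1,2\}$, $\sum_{1\le k\le k(n)} q_{k,n}/p_{k,n}^h\to\lambda$ as $n\to+\infty$ (the same $\lambda$ for both values of $h$); (GN4) for every $0<\varepsilon<1$, setting for $n\ge 1$ and $1\le k\le k(n)$ $$B(\varepsilon,k,n)=\sum_{j=0}^{+\infty} 1_{\left(\left|j-\frac{q_{k,n}}{p_{k,n}}-1\right|\ge\varepsilon\right)}\left(j-\frac{q_{k,n}}{p_{k,n}}\right)^2 p_{k,n}\,q_{k,n}^{j},$$ one has $B(\varepsilon,n)=\sum_{k=1}^{k(n)}B(\varepsilon,k,n)\to 0$ as $n\to+\infty$. Then $S_n[X]=\sum_{k=1}^{k(n)}X_{k,n}$ converges in distribution, as $n\to+\infty$, to the Poisson law $\mathcal{P}(\lambda)$.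
   Context: The corrected geometric law $\mathcal{G}^{\ast}(p)=\mathcal{G}(p)-1$, $0<p<1$, is the law of $Y-1$ where $Y$ is geometric with parameter $p$ on $\{1,2,\dots\}$; that is, $X\sim\mathcal{G}^{\ast}(p)$ means $\mathbb{P}(X=j)=p(1-p)^j$ for $j=0,1,2,\dots$. $\mathcal{P}(\lambda)$ denotes the Poisson law with parameter $\lambda$. $1_{(A)}$ equals $1$ if condition $A$ holds and $0$ otherwise. Within a row the variables need not be identically distributed, and nothing is assumed about dependence between different rows. *)

theory Defs
  imports "HOL-Probability.Probability" "HOL-Real_Asymp.Real_Asymp"
begin

text \<open>
  Discrete laws on the natural numbers are pushed forward along \<^term>\<open>real\<close>, so that they can be
  compared with laws of real random variables and used with \<^const>\<open>weak_conv_m\<close>.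
  The library's \<^const>\<open>geometric_pmf\<close> counts failures before the first success, hence it already is
  the corrected geometric law; no further shift is needed.
\<close>

definition corrected_geometric :: "real \<Rightarrow> real measure" where
  "corrected_geometric p = distr (measure_pmf (geometric_pmf p)) borel real"

definition poisson_law :: "real \<Rightarrow> real measure" where
  "poisson_law r = distr (measure_pmf (poisson_pmf r)) borel real"

lemma measure_corrected_geometric:
  assumes "0 < p" "p < 1"
  shows "measure (corrected_geometric p) {real j} = p * (1 - p) ^ j"
proof -
  have "real -` {real j} = {j}" by auto
  then show ?thesis
    using assms by (simp add: corrected_geometric_def measure_distr measure_pmf_single)
qed

lemma measure_poisson_law:
  assumes "0 < r"
  shows "measure (poisson_law r) {real j} = r ^ j / fact j * exp (- r)"
proof -
  have "real -` {real j} = {j}" by auto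
  then show ?thesis
    using assms by (simp add: poisson_law_def measure_distr measure_pmf_single)
qed

text \<open>
  For \<^prop>\<open>0 < p\<close> and \<^prop>\<open>q = 1 - p\<close>, \<open>q / p\<close> is the mean of the corrected geometric law. The series
  then converges (the weights decay geometrically), so the real-valued sum is meaningful.
\<close>

definition B_term :: "real \<Rightarrow> real \<Rightarrow> real \<Rightarrow> real" where
  "B_term \<epsilon> p q =
     (\<Sum>j. (if \<bar>real j - q / p - 1\<bar> \<ge> \<epsilon> then 1 else 0) * (real j - q / p)\<^sup>2 * p * q ^ j)"

lemma summable_B_term:
  assumes "0 < p" "p < 1" "q = 1 - p"
  shows "summable (\<lambda>j. (if \<bar>real j - q / p - 1\<bar> \<ge> \<epsilon> then 1 else 0) * (real j - q / p)\<^sup>2 * p * q ^ j)"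
proof (rule summable_comparison_test_bigo)
  have q: "0 < q" "q < 1" using assms by auto
  define r where "r = (1 + q) / 2"
  have r: "q < r" "0 < r" "r < 1" using q by (auto simp: r_def)
  then show "summable (\<lambda>j. norm (r ^ j))" by (simp add: summable_geometric)
  have "(\<lambda>j. (real j - q / p)\<^sup>2 * p * q ^ j) \<in> O(\<lambda>j. r ^ j)"
    using q r assms(1) by real_asymp
  then show "(\<lambda>j. (if \<bar>real j - q / p - 1\<bar> \<ge> \<epsilon> then 1 else 0) * (real j - q / p)\<^sup>2 * p * q ^ j)
               \<in> O(\<lambda>j. r ^ j)"
    by (rule landau_o.big.trans[rotated]) (intro landau_o.bigI[of 1], auto)
qed

end

theory Submission
  imports Defs
begin

text \<open>
  By Levy's continuity theorem it suffices to treat characteristic functions. With \<open>a = q / p\<close> and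
  \<open>w = a * (iexp t - 1)\<close>, the corrected geometric law has characteristic function \<open>1 / (1 - w)\<close>, which
  differs from \<open>exp w\<close> by at most \<open>2 * \<bar>w\<bar>\<^sup>2\<close> because \<open>Re w \<le> 0\<close>. All factors lie in the unit disc, so
  the product over a row differs from \<open>exp (\<Sum> w)\<close> by at most \<open>8 * (\<Sum> a\<^sup>2)\<close>. Finally
  \<open>a\<^sup>2 = q / p\<^sup>2 - q / p\<close>, so that by (GN3) \<open>\<Sum> a\<^sup>2\<close> tends to \<open>0\<close> while \<open>\<Sum> w\<close> tends to
  \<open>lam * (iexp t - 1)\<close>.
\<close>

text \<open>Since \<open>iexp t\<close> has modulus 1, the expectation of \<open>iexp t ^ j\<close>
  is an absolutely convergent series, the generating function of \<open>P\<close> at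
  \<open>iexp t\<close>. Uniqueness of sums then yields both characteristic functions below.\<close>

lemma char_distr_nat_pmf:
  fixes P :: "nat pmf"
  shows "(\<lambda>j. of_real (pmf P j) * iexp t ^ j) sums char (distr (measure_pmf P) borel real) t"
proof -
  have pow: "iexp (t * real j) = iexp t ^ j" for j
    by (simp add: exp_of_nat_mult [symmetric] mult_ac)
  have "integrable (measure_pmf P) (\<lambda>j. iexp t ^ j)"
    by (rule measure_pmf.integrable_const_bound[of _ 1])
       (simp_all add: norm_power)
  then have "integrable (count_space UNIV) (\<lambda>j. pmf P j *\<^sub>R iexp t ^ j)"
    unfolding measure_pmf_eq_density by (simp add: integrable_density)
  then have "(\<lambda>j. pmf P j *\<^sub>R iexp t ^ j) sums (LINT j|count_space UNIV. pmf P j *\<^sub>R iexp t ^ j)"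
    by (rule sums_integral_count_space_nat)
  also have "(LINT j|count_space UNIV. pmf P j *\<^sub>R iexp t ^ j) = (LINT j|measure_pmf P. iexp t ^ j)"
    unfolding measure_pmf_eq_density by (simp add: integral_density)
  also have "\<dots> = char (distr (measure_pmf P) borel real) t"
    unfolding char_def by (subst integral_distr) (simp_all add: pow del: of_real_mult)
  finally show ?thesis
    by (simp add: scaleR_conv_of_real)
qed

text \<open>A geometric series of ratio \<open>(1 - p) * iexp t\<close>. Factoring \<open>p\<close>
  out of the denominator leaves only the mean \<open>(1 - p) / p\<close>, the same place that
  \<open>r\<close> takes in the Poisson exponent.\<close>

lemma char_corrected_geometric:
  assumes "0 < p" "p < 1"
  shows "char (corrected_geometric p) t = 1 / (1 - of_real ((1 - p) / p) * (iexp t - 1))"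
proof -
  have "cmod (of_real (1 - p) * iexp t) < 1"
    using assms by (simp add: norm_mult del: of_real_diff)
  from sums_mult[OF geometric_sums[OF this], of "of_real p"]
  have "(\<lambda>j. of_real (pmf (geometric_pmf p) j) * iexp t ^ j) sums
          (of_real p * (1 / (1 - of_real (1 - p) * iexp t)))"
    using assms by (simp add: power_mult_distrib mult_ac)
  then have "char (corrected_geometric p) t = of_real p * (1 / (1 - of_real (1 - p) * iexp t))"
    unfolding corrected_geometric_def using char_distr_nat_pmf sums_unique2 by blast
  also have "1 - of_real (1 - p) * iexp t
      = of_real p * (1 - of_real ((1 - p) / p) * (iexp t - 1))"
    using assms by (simp add: field_simps)
  finally show ?thesis
    using assms by simp
qed

lemma char_poisson_law:
  assumes "0 < r"
  shows "char (poisson_law r) t = exp (of_real r * (iexp t - 1))"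
proof -
  have "(\<lambda>j. of_real (exp (- r)) * ((of_real r * iexp t) ^ j /\<^sub>R fact j)) sums
          (of_real (exp (- r)) * exp (of_real r * iexp t))"
    by (intro sums_mult exp_converges)
  then have "(\<lambda>j. of_real (pmf (poisson_pmf r) j) * iexp t ^ j) sums
          (of_real (exp (- r)) * exp (of_real r * iexp t))"
    using assms by (simp add: scaleR_conv_of_real power_mult_distrib field_simps)
  then have "char (poisson_law r) t = of_real (exp (- r)) * exp (of_real r * iexp t)"
    unfolding poisson_law_def using char_distr_nat_pmf sums_unique2 by blast
  also have "\<dots> = exp (of_real r * (iexp t - 1))"
    by (simp add: exp_of_real [symmetric] exp_add [symmetric] algebra_simps del: exp_of_real)
  finally show ?thesis .
qed

lemma cmod_one_minus_ge_1:
  assumes "Re w \<le> 0"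
  shows "1 \<le> cmod (1 - w)"
  using complex_Re_le_cmod[of "1 - w"] assms by simp

text \<open>Both functions have first-order expansion \<open>1 + w\<close> at 0, and on the left
  half-plane each remainder is at most the square of \<open>cmod w\<close>.\<close>

lemma cmod_inverse_minus_exp_le:
  assumes "Re w \<le> 0"
  shows "cmod (1 / (1 - w) - exp w) \<le> 2 * (cmod w)\<^sup>2"
proof -
  note ge1 = cmod_one_minus_ge_1[OF assms]
  then have "1 - w \<noteq> 0" by auto
  then have "1 / (1 - w) - (1 + w) = w\<^sup>2 / (1 - w)"
    by (simp add: field_simps power2_eq_square)
  then have "cmod (1 / (1 - w) - (1 + w)) = (cmod w)\<^sup>2 / cmod (1 - w)"
    by (simp add: norm_divide norm_power)
  also have "\<dots> \<le> (cmod w)\<^sup>2 / 1"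
    using ge1 by (intro divide_left_mono) auto
  finally have 1: "cmod (1 / (1 - w) - (1 + w)) \<le> (cmod w)\<^sup>2" by simp
  \<comment> \<open>Taylor expansion at 0 on the convex set \<open>Re z \<le> 0\<close>, where every
    derivative of \<open>exp\<close> is bounded by the leading factor 1.\<close>
  have "cmod (exp w - (\<Sum>i\<le>1. exp 0 * (w - 0) ^ i / fact i)) \<le> 1 * cmod (w - 0) ^ Suc 1 / fact 1"
    by (rule complex_Taylor[where S = "{z. Re z \<le> 0}" and f = "\<lambda>_. exp"])
       (use assms in \<open>auto intro!: derivative_eq_intros simp: convex_halfspace_Re_le\<close>)
  then have 2: "cmod (exp w - (1 + w)) \<le> (cmod w)\<^sup>2"
    by (simp add: power2_eq_square)
  have "cmod (1 / (1 - w) - exp w) \<le> cmod (1 / (1 - w) - (1 + w)) + cmod (exp w - (1 + w))"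
    by (metis norm_triangle_ineq4 diff_diff_eq2 diff_add_cancel add_diff_eq)
  with 1 2 show ?thesis by simp
qed

theorem theorem4:
  fixes M :: "'a measure"
    and X :: "nat \<Rightarrow> nat \<Rightarrow> 'a \<Rightarrow> real"
    and p q :: "nat \<Rightarrow> nat \<Rightarrow> real"
    and kn :: "nat \<Rightarrow> nat"
    and lam :: real
  assumes "prob_space M"
    and kn_pos: "\<And>n. n \<ge> 1 \<Longrightarrow> kn n \<ge> 1"
    and kn_lim: "filterlim kn at_top sequentially"
    and indep: "\<And>n. n \<ge> 1 \<Longrightarrow> prob_space.indep_vars M (\<lambda>_. borel) (\<lambda>k. X k n) {1..kn n}"
    and GN1_law: "\<And>n k. n \<ge> 1 \<Longrightarrow> k \<in> {1..kn n} \<Longrightarrow>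
          distr M borel (X k n) = corrected_geometric (p k n)"
    and GN1_pq: "\<And>n k. n \<ge> 1 \<Longrightarrow> k \<in> {1..kn n} \<Longrightarrow>
          0 < p k n \<and> p k n = 1 - q k n \<and> p k n < 1"
    and GN2: "(\<lambda>n. SUP k\<in>{1..kn n}. q k n / (p k n)\<^sup>2) \<longlonglongrightarrow> 0"
    and lambda_pos: "0 < lam"
    and GN3: "\<And>h. h \<in> {1, 2 :: nat} \<Longrightarrow> (\<lambda>n. \<Sum>k\<in>{1..kn n}. q k n / p k n ^ h) \<longlonglongrightarrow> lam"
    and GN4: "\<And>\<epsilon>. 0 < \<epsilon> \<Longrightarrow> \<epsilon> < 1 \<Longrightarrow>
          (\<lambda>n. \<Sum>k\<in>{1..kn n}. B_term \<epsilon> (p k n) (q k n)) \<longlonglongrightarrow> 0"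
  shows "weak_conv_m (\<lambda>n. distr M borel (\<lambda>\<omega>. \<Sum>k\<in>{1..kn n}. X k n \<omega>)) (poisson_law lam)"
proof -
  interpret prob_space M by fact
  define S where "S n \<omega> = (\<Sum>k\<in>{1..kn n}. X k n \<omega>)" for n \<omega>
  define a where "a k n = q k n / p k n" for k n
  have X_meas: "X k n \<in> borel_measurable M" if "n \<ge> 1" "k \<in> {1..kn n}" for k n
    using indep[OF that(1)] that(2) by (auto simp: indep_vars_def)
  have S_meas: "S n \<in> borel_measurable M" if "n \<ge> 1" for n
    unfolding S_def using X_meas[OF that] by measurable
  have a_pos: "0 \<le> a k n" if "n \<ge> 1" "k \<in> {1..kn n}" for k n
    using GN1_pq[OF that] by (simp add: a_def)
  have a_sum: "(\<lambda>n. \<Sum>k\<in>{1..kn n}. a k n) \<longlonglongrightarrow> lam"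
    using GN3[of 1] by (simp add: a_def)
  \<comment> \<open>Here it matters that both exponents in \<open>GN3\<close> share the same
    limit.\<close>
  have "(\<lambda>n. (\<Sum>k\<in>{1..kn n}. q k n / (p k n)\<^sup>2) - (\<Sum>k\<in>{1..kn n}. a k n)) \<longlonglongrightarrow> lam - lam"
    by (intro tendsto_diff a_sum GN3) simp
  moreover have "(a k n)\<^sup>2 = q k n / (p k n)\<^sup>2 - a k n" if "n \<ge> 1" "k \<in> {1..kn n}" for k n
  proof -
    from GN1_pq[OF that] have "p k n \<noteq> 0" and q: "q k n = 1 - p k n" by auto
    then show ?thesis unfolding a_def q by (simp add: field_simps power2_eq_square)
  qed
  then have "\<forall>\<^sub>F n in sequentially.
      (\<Sum>k\<in>{1..kn n}. q k n / (p k n)\<^sup>2) - (\<Sum>k\<in>{1..kn n}. a k n) = (\<Sum>k\<in>{1..kn n}. (a k n)\<^sup>2)"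
    by (intro eventually_sequentiallyI[of 1]) (simp add: sum_subtractf)
  ultimately have a2_sum: "(\<lambda>n. \<Sum>k\<in>{1..kn n}. (a k n)\<^sup>2) \<longlonglongrightarrow> 0"
    by (simp add: filterlim_cong)

  have char_lim: "(\<lambda>n. char (distr M borel (S n)) t) \<longlonglongrightarrow> char (poisson_law lam) t" for t
  proof -
    define w where "w k n = of_real (a k n) * (iexp t - 1)" for k n
    have Re_w: "Re (w k n) \<le> 0" if "n \<ge> 1" "k \<in> {1..kn n}" for k n
      \<comment> \<open>The real part is \<open>a k n * (cos t - 1)\<close>.\<close>
      using a_pos[OF that] by (simp add: w_def Re_exp mult_nonneg_nonpos)
    have cmod_w: "(cmod (w k n))\<^sup>2 \<le> 4 * (a k n)\<^sup>2" for k n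
    proof -
      have "cmod (iexp t - 1) \<le> 2"
        using norm_triangle_ineq4[of "iexp t" 1] by simp
      then have "(cmod (iexp t - 1))\<^sup>2 \<le> 2\<^sup>2"
        by (intro power_mono) auto
      then have "(a k n)\<^sup>2 * (cmod (iexp t - 1))\<^sup>2 \<le> (a k n)\<^sup>2 * 2\<^sup>2"
        by (intro mult_left_mono) auto
      then show ?thesis
        by (simp add: w_def norm_mult power_mult_distrib)
    qed
    have char_S: "char (distr M borel (S n)) t = (\<Prod>k\<in>{1..kn n}. 1 / (1 - w k n))"
      if n: "n \<ge> 1" for n
    proof -
      have "char (distr M borel (S n)) t = (\<Prod>k\<in>{1..kn n}. char (distr M borel (X k n)) t)"
        unfolding S_def by (rule char_distr_sum[OF indep[OF n]])
      also have "\<dots> = (\<Prod>k\<in>{1..kn n}. 1 / (1 - w k n))"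
      proof (rule prod.cong[OF refl])
        fix k assume k: "k \<in> {1..kn n}"
        from GN1_pq[OF n k] have "0 < p k n" "p k n < 1" "q k n = 1 - p k n" by auto
        then show "char (distr M borel (X k n)) t = 1 / (1 - w k n)"
          by (simp only: GN1_law[OF n k] char_corrected_geometric w_def a_def)
      qed
      finally show ?thesis .
    qed
    have bound: "cmod (char (distr M borel (S n)) t - exp (\<Sum>k\<in>{1..kn n}. w k n))
        \<le> 8 * (\<Sum>k\<in>{1..kn n}. (a k n)\<^sup>2)" if n: "n \<ge> 1" for n
    proof -
      have "cmod (char (distr M borel (S n)) t - exp (\<Sum>k\<in>{1..kn n}. w k n))
          = cmod ((\<Prod>k\<in>{1..kn n}. 1 / (1 - w k n)) - (\<Prod>k\<in>{1..kn n}. exp (w k n)))"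
        by (simp only: char_S[OF n] exp_sum[OF finite_atLeastAtMost])
      also have "\<dots> \<le> (\<Sum>k\<in>{1..kn n}. cmod (1 / (1 - w k n) - exp (w k n)))"
      \<comment> \<open>Replacing the factors one at a time costs only the sum of their differences,
        as all of them lie in the closed unit disc.\<close>
      proof (rule norm_prod_diff)
        fix k assume k: "k \<in> {1..kn n}"
        show "cmod (1 / (1 - w k n)) \<le> 1"
          using cmod_one_minus_ge_1[OF Re_w[OF n k]] by (simp add: norm_divide divide_le_eq)
        show "cmod (exp (w k n)) \<le> 1"
          using Re_w[OF n k] by simp
      qed
      also have "\<dots> \<le> (\<Sum>k\<in>{1..kn n}. 8 * (a k n)\<^sup>2)"
      proof (rule sum_mono)
        fix k assume k: "k \<in> {1..kn n}"
        \<comment> \<open>The constant 8 is 2 from the comparison with \<open>exp\<close> times 4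
          from \<open>cmod_w\<close>.\<close>
        show "cmod (1 / (1 - w k n) - exp (w k n)) \<le> 8 * (a k n)\<^sup>2"
          using cmod_inverse_minus_exp_le[OF Re_w[OF n k]] cmod_w[of k n] by linarith
      qed
      finally show ?thesis by (simp only: sum_distrib_left)
    qed
    have "(\<lambda>n. char (distr M borel (S n)) t - exp (\<Sum>k\<in>{1..kn n}. w k n)) \<longlonglongrightarrow> 0"
    proof (rule Lim_null_comparison)
      show "\<forall>\<^sub>F n in sequentially. cmod (char (distr M borel (S n)) t - exp (\<Sum>k\<in>{1..kn n}. w k n))
          \<le> 8 * (\<Sum>k\<in>{1..kn n}. (a k n)\<^sup>2)"
        using bound by (rule eventually_sequentiallyI)
      show "(\<lambda>n. 8 * (\<Sum>k\<in>{1..kn n}. (a k n)\<^sup>2)) \<longlonglongrightarrow> 0"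
        using tendsto_mult_right_zero[OF a2_sum] .
    qed
    moreover have "(\<lambda>n. exp (\<Sum>k\<in>{1..kn n}. w k n)) \<longlonglongrightarrow> char (poisson_law lam) t"
      unfolding w_def sum_distrib_right[symmetric] of_real_sum[symmetric]
        char_poisson_law[OF lambda_pos]
      by (intro tendsto_intros a_sum)
    ultimately show ?thesis
      using tendsto_add by fastforce
  qed

  \<comment> \<open>Nothing is assumed about row \<open>0\<close>, so Levy's theorem applies only to the shifted sequence.\<close>
  have "weak_conv_m (\<lambda>n. distr M borel (S (Suc n))) (poisson_law lam)"
  proof (rule levy_continuity)
    show "real_distribution (distr M borel (S (Suc n)))" for n
      by (intro real_distribution_distr S_meas) simp
    show "real_distribution (poisson_law lam)"
      unfolding poisson_law_def by (intro prob_space.real_distribution_distr prob_space_measure_pmf) simp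
    show "(\<lambda>n. char (distr M borel (S (Suc n))) t) \<longlonglongrightarrow> char (poisson_law lam) t" for t
      using LIMSEQ_Suc[OF char_lim] .
  qed
  \<comment> \<open>Weak convergence is pointwise convergence of the \<open>cdf\<close> at
    continuity points of the limit, so the shift can be undone at each such point.\<close>
  then have "weak_conv_m (\<lambda>n. distr M borel (S n)) (poisson_law lam)"
    unfolding weak_conv_m_def weak_conv_def
    using LIMSEQ_imp_Suc[of "\<lambda>n. cdf (distr M borel (S n)) x" for x] by auto
  then show ?thesis
    by (simp only: S_def[abs_def])
qed

end
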